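(* Let $\beta\in(0,1)$ and $\rho\in(0,1)$. Let $(X_n)_{n\ge0}$ be a stationary autoregressive process $X_n=\rho X_{n-1}+\epsilon_n$, $n\ge1$, where $(\epsilon_n)_{n\ge 1}$ are i.i.d. and $\epsilon_n$ is independent of $X_{n-1}$, and suppose that each marginal is one-sided stable with $\mathbb{E}(e^{-sX_n})=e^{-s^\beta}$ for $s>0$. Then $$\mathbb{E}\left(e^{-s\epsilon_n}\right)=e^{-(1-\rho^\beta)s^\beta},\qquad s>0,$$ that is, $\epsilon_n$ has the same distribution as $(1-\rho^\beta)^{1/\beta}S$, where $S$ is a one-sided stable random variable with $\mathbb{E}(e^{-sS})=e^{-s^\beta}$ for $s>0$. In particular, if the AR(1) series is stable, then the error term is also stable.
   Context: A one-sided (positive) stable random variable $S$ of index $\beta\in(0,1)$ is a positive random variable with Laplace transform $\mathbb{E}(e^{-sS})=e^{-s^\beta}$, $s>0$. *)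

theory Defs imports "HOL-Probability.Probability" begin

text \<open>
  The Bochner integral of a non-integrable function is 0, so requiring the (nonzero) value
  of the Laplace transform below also forces the integrand to be integrable.
\<close>

definition std_one_sided_stable :: "'a measure \<Rightarrow> real \<Rightarrow> ('a \<Rightarrow> real) \<Rightarrow> bool" where
  "std_one_sided_stable M \<beta> S \<longleftrightarrow>
     S \<in> borel_measurable M \<and> (AE \<omega> in M. 0 < S \<omega>) \<and>
     (\<forall>s>0. (\<integral>\<omega>. exp (- (s * S \<omega>)) \<partial>M) = exp (- (s powr \<beta>)))"

text \<open>
  Stability is a property of the law up to a positive scale factor: \<open>Y\<close> is one-sided stable
  of index \<open>\<beta>\<close> if it is a positive multiple of a variable normalised as above.
\<close>

definition one_sided_stable :: "'a measure \<Rightarrow> real \<Rightarrow> ('a \<Rightarrow> real) \<Rightarrow> bool" where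
  "one_sided_stable M \<beta> Y \<longleftrightarrow> (\<exists>c>0. std_one_sided_stable M \<beta> (\<lambda>\<omega>. Y \<omega> / c))"

definition strictly_stationary :: "'a measure \<Rightarrow> (nat \<Rightarrow> 'a \<Rightarrow> real) \<Rightarrow> bool" where
  "strictly_stationary M X \<longleftrightarrow>
     (\<forall>n. X n \<in> borel_measurable M) \<and>
     (\<forall>h. distr M (\<Pi>\<^sub>M n\<in>UNIV. borel) (\<lambda>\<omega> n. X (n + h) \<omega>) =
          distr M (\<Pi>\<^sub>M n\<in>UNIV. borel) (\<lambda>\<omega> n. X n \<omega>))"

end

theory Submission imports Defs "HOL-Real_Asymp.Real_Asymp" begin

text \<open>
  Since \<open>\<epsilon> n\<close> is independent of \<open>X (n - 1)\<close>, the recursion turns into a factorisation of Laplace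
  transforms, \<open>exp (- (s powr \<beta>)) = exp (- ((\<rho> * s) powr \<beta>)) * E exp (- (s * \<epsilon> n))\<close>, and dividing gives
  the transform of \<open>\<epsilon> n\<close> (lemma \<open>Laplace_cancel_indep\<close>). It is also the transform of
  \<open>(1 - \<rho> powr \<beta>) powr (1 / \<beta>) * S\<close>, so the identification of the law is a matter of uniqueness.

  Uniqueness (\<open>distr_eqI_Laplace\<close>) holds for nonnegative variables and is obtained from moments
  rather than by analytic continuation: the Laplace transform of \<open>Y\<close> at the natural numbers lists
  the moments of \<open>exp (- Y)\<close>, a variable with values in the unit interval, and a bounded law is
  determined by its moments because its characteristic function is the limit of its Taylor
  polynomials (\<open>bounded_distr_eqI_moments\<close>).

  Nothing is assumed about the sign of \<open>\<epsilon> n\<close>, and a difference of positive variables need not be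
  positive. Positivity is read off the transform itself: it tends to 0 at infinity, whereas it would
  stay above the probability of \<open>\<epsilon> n \<le> 0\<close> (\<open>AE_pos_if_Laplace_tendsto_0\<close>).
\<close>

section \<open>Bounded laws are determined by their moments\<close>

lemma (in prob_space) integrable_bounded_power:
  fixes U :: "'a \<Rightarrow> real"
  assumes [measurable]: "random_variable borel U" and "AE \<omega> in M. \<bar>U \<omega>\<bar> \<le> B"
  shows "integrable M (\<lambda>\<omega>. U \<omega> ^ k)"
proof (rule integrable_const_bound[where B = "B ^ k"])
  show "AE \<omega> in M. norm (U \<omega> ^ k) \<le> B ^ k"
    using assms(2) by eventually_elim (simp add: power_abs power_mono)
qed simp

text \<open>
  The error in the Taylor expansion of a characteristic function is controlled by the absolute
  moment of the same order; boundedness makes that moment grow only geometrically, so the factorial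
  drives the error to 0 for every \<open>t\<close>.
\<close>

lemma (in prob_space) char_moment_bound:
  fixes U :: "'a \<Rightarrow> real"
  assumes U[measurable]: "random_variable borel U" and bound: "AE \<omega> in M. \<bar>U \<omega>\<bar> \<le> B"
  shows "cmod (char (distr M borel U) t
      - (\<Sum>k\<le>n. ((\<i> * t) ^ k / fact k) * expectation (\<lambda>\<omega>. U \<omega> ^ k)))
    \<le> 2 * (\<bar>t\<bar> * B) ^ n / fact n"
proof -
  have "expectation (\<lambda>\<omega>. \<bar>U \<omega>\<bar> ^ n) \<le> expectation (\<lambda>\<omega>. B ^ n)"
  proof (rule integral_mono_AE)
    show "integrable M (\<lambda>\<omega>. \<bar>U \<omega>\<bar> ^ n)"
      using integrable_bounded_power[of "\<lambda>\<omega>. \<bar>U \<omega>\<bar>" B n] bound by simp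
    show "AE \<omega> in M. \<bar>U \<omega>\<bar> ^ n \<le> B ^ n"
      using bound by eventually_elim (simp add: power_mono)
  qed simp
  then have "expectation (\<lambda>\<omega>. \<bar>U \<omega>\<bar> ^ n) \<le> B ^ n"
    by (simp add: prob_space)
  then have "(2 * \<bar>t\<bar> ^ n / fact n) * expectation (\<lambda>\<omega>. \<bar>U \<omega>\<bar> ^ n) \<le> (2 * \<bar>t\<bar> ^ n / fact n) * B ^ n"
    by (intro mult_left_mono) auto
  also have "\<dots> = 2 * (\<bar>t\<bar> * B) ^ n / fact n"
    by (simp add: power_mult_distrib)
  finally show ?thesis
    using char_approx1'[where n = n and t = t, OF integrable_bounded_power[OF U bound] U refl] by linarith
qed

text \<open>
  Both characteristic functions are limits of one and the same sequence of Taylor polynomials.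
\<close>

theorem bounded_distr_eqI_moments:
  fixes U :: "'a \<Rightarrow> real" and V :: "'b \<Rightarrow> real"
  assumes "prob_space M" "prob_space N"
    and U: "U \<in> borel_measurable M" "AE \<omega> in M. \<bar>U \<omega>\<bar> \<le> B"
    and V: "V \<in> borel_measurable N" "AE \<omega> in N. \<bar>V \<omega>\<bar> \<le> B"
    and moments: "\<And>k. (\<integral>\<omega>. U \<omega> ^ k \<partial>M) = (\<integral>\<omega>. V \<omega> ^ k \<partial>N)"
  shows "distr M borel U = distr N borel V"
proof -
  interpret M: prob_space M by fact
  interpret N: prob_space N by fact
  have "char (distr M borel U) t = char (distr N borel V) t" (is "?a = ?b") for t
  proof -
    define p where "p n = (\<Sum>k\<le>n. ((\<i> * t) ^ k / fact k) * (\<integral>\<omega>. U \<omega> ^ k \<partial>M))" for n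
    have "(\<lambda>n. (\<bar>t\<bar> * B) ^ n / fact n) \<longlonglongrightarrow> 0"
      using summable_LIMSEQ_zero[OF summable_exp[of "\<bar>t\<bar> * B"]]
      by (simp add: field_simps)
    from tendsto_mult_right_zero[OF this, of 2]
    have lim: "(\<lambda>n. 2 * (\<bar>t\<bar> * B) ^ n / fact n) \<longlonglongrightarrow> 0"
      by simp
    have "(\<lambda>n. ?a - p n) \<longlonglongrightarrow> 0"
      by (rule Lim_null_comparison[OF _ lim])
         (intro always_eventually allI, unfold p_def, rule M.char_moment_bound[OF U])
    moreover have "(\<lambda>n. ?b - p n) \<longlonglongrightarrow> 0"
      by (rule Lim_null_comparison[OF _ lim])
         (intro always_eventually allI, unfold p_def moments, rule N.char_moment_bound[OF V])
    ultimately have "(\<lambda>n. (?a - p n) - (?b - p n)) \<longlonglongrightarrow> 0 - 0"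
      by (rule tendsto_diff)
    then show ?thesis
      by (simp add: LIMSEQ_const_iff)
  qed
  then show ?thesis
    using U(1) V(1)
    by (intro Levy_uniqueness M.real_distribution_distr N.real_distribution_distr ext) auto
qed

section \<open>The Laplace transform determines a law on the half-line\<close>

text \<open>
  The map \<open>y \<mapsto> exp (- y)\<close> is injective and sends the half-line into the unit interval, so it
  reduces the claim to the moment problem for bounded laws.
\<close>

theorem distr_eqI_Laplace:
  fixes Y :: "'a \<Rightarrow> real" and Z :: "'b \<Rightarrow> real"
  assumes "prob_space M" "prob_space N"
    and Y[measurable]: "Y \<in> borel_measurable M" and Y0: "AE \<omega> in M. 0 \<le> Y \<omega>"
    and Z[measurable]: "Z \<in> borel_measurable N" and Z0: "AE \<omega> in N. 0 \<le> Z \<omega>"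
    and Laplace: "\<And>s. 0 < s \<Longrightarrow> (\<integral>\<omega>. exp (- (s * Y \<omega>)) \<partial>M) = (\<integral>\<omega>. exp (- (s * Z \<omega>)) \<partial>N)"
  shows "distr M borel Y = distr N borel Z"
proof -
  interpret M: prob_space M by fact
  interpret N: prob_space N by fact
  have "distr M borel (\<lambda>\<omega>. exp (- Y \<omega>)) = distr N borel (\<lambda>\<omega>. exp (- Z \<omega>))"
  proof (rule bounded_distr_eqI_moments[where B = 1])
    show "AE \<omega> in M. \<bar>exp (- Y \<omega>)\<bar> \<le> 1" "AE \<omega> in N. \<bar>exp (- Z \<omega>)\<bar> \<le> 1"
      using Y0 Z0 by auto
    show "(\<integral>\<omega>. exp (- Y \<omega>) ^ k \<partial>M) = (\<integral>\<omega>. exp (- Z \<omega>) ^ k \<partial>N)" for k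
      using Laplace[of "real k"]
      by (cases "k = 0") (simp_all add: M.prob_space N.prob_space flip: exp_of_nat_mult)
  qed (use assms in simp_all)
  then have "distr (distr M borel (\<lambda>\<omega>. exp (- Y \<omega>))) borel (\<lambda>x. - ln x)
      = distr (distr N borel (\<lambda>\<omega>. exp (- Z \<omega>))) borel (\<lambda>x. - ln x)"
    by simp
  then show ?thesis
    by (simp add: distr_distr comp_def)
qed

section \<open>Decay of the Laplace transform and positivity\<close>

text \<open>
  For \<open>s > 0\<close> the integrand is at least 1 wherever \<open>Y \<le> 0\<close>, so the transform dominates the
  probability of that event uniformly in \<open>s\<close>.
\<close>

lemma (in prob_space) AE_pos_if_Laplace_tendsto_0:
  fixes Y :: "'a \<Rightarrow> real"
  assumes Y[measurable]: "random_variable borel Y"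
    and int: "\<And>s. 0 < s \<Longrightarrow> integrable M (\<lambda>\<omega>. exp (- (s * Y \<omega>)))"
    and lim: "((\<lambda>s. expectation (\<lambda>\<omega>. exp (- (s * Y \<omega>)))) \<longlongrightarrow> 0) at_top"
  shows "AE \<omega> in M. 0 < Y \<omega>"
proof -
  let ?A = "{\<omega> \<in> space M. Y \<omega> \<le> 0}"
  have "prob ?A \<le> expectation (\<lambda>\<omega>. exp (- (s * Y \<omega>)))" if "0 < s" for s
  proof -
    have "prob ?A = expectation (indicator ?A)"
      by simp
    also have "\<dots> \<le> expectation (\<lambda>\<omega>. exp (- (s * Y \<omega>)))"
      using that
      by (intro integral_mono int)
         (auto simp: indicator_def mult_nonneg_nonpos emeasure_eq_measure intro!: integrable_real_indicator)
    finally show ?thesis .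
  qed
  then have "prob ?A \<le> 0"
    by (intro tendsto_lowerbound[OF lim]) (auto intro: eventually_mono[OF eventually_gt_at_top[of 0]])
  then have "prob ?A = 0"
    by (simp add: measure_le_0_iff)
  then have "AE \<omega> in M. \<omega> \<notin> ?A"
    by (subst (asm) prob_eq_0) auto
  then show ?thesis
    by (rule AE_mp) (auto intro!: AE_I2)
qed

section \<open>Cancelling an independent summand\<close>

lemma (in prob_space) indep_var_nn_integral_mult:
  fixes U V :: "'a \<Rightarrow> ennreal"
  assumes "indep_var borel U borel V"
  shows "(\<integral>\<^sup>+\<omega>. U \<omega> * V \<omega> \<partial>M) = (\<integral>\<^sup>+\<omega>. U \<omega> \<partial>M) * (\<integral>\<^sup>+\<omega>. V \<omega> \<partial>M)"
proof -
  have "case_bool borel borel = (\<lambda>_. borel :: ennreal measure)"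
    by (auto split: bool.split)
  with assms have "indep_vars (\<lambda>_. borel) (case_bool U V) UNIV"
    by (simp add: indep_var_def)
  from indep_vars_nn_integral[OF _ this] show ?thesis
    by (simp add: UNIV_bool mult.commute)
qed

text \<open>
  The sign of \<open>Y\<close> is unknown, so the integrability of \<open>exp (- (s * Y))\<close> is not given in advance.
  The factorisation is therefore carried out for extended nonnegative integrals; the finite nonzero factor of \<open>X\<close> is then cancelled, and integrability follows from
  finiteness of the quotient. That the two given transforms are exponentials makes them nonzero.
\<close>

lemma (in prob_space) Laplace_cancel_indep:
  fixes W X Y :: "'a \<Rightarrow> real"
  assumes indep: "indep_var borel Y borel X"
    and sum: "AE \<omega> in M. W \<omega> = X \<omega> + Y \<omega>"
    and W: "random_variable borel W"
    and LW: "expectation (\<lambda>\<omega>. exp (- (s * W \<omega>))) = exp a"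
    and LX: "expectation (\<lambda>\<omega>. exp (- (s * X \<omega>))) = exp b"
  shows "integrable M (\<lambda>\<omega>. exp (- (s * Y \<omega>)))"
    and "expectation (\<lambda>\<omega>. exp (- (s * Y \<omega>))) = exp (a - b)"
proof -
  note [measurable] = W indep_var_rv1[OF indep] indep_var_rv2[OF indep]
  have nn: "(\<integral>\<^sup>+\<omega>. ennreal (exp (- (s * Z \<omega>))) \<partial>M) = ennreal (exp c)"
    if "expectation (\<lambda>\<omega>. exp (- (s * Z \<omega>))) = exp c" for Z :: "'a \<Rightarrow> real" and c
  proof -
    \<comment> \<open>A non-integrable function would have Bochner integral 0.\<close>
    have "integrable M (\<lambda>\<omega>. exp (- (s * Z \<omega>)))"
      using that by (metis not_integrable_integral_eq exp_not_eq_zero)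
    from nn_integral_eq_integral[OF this] that show ?thesis by simp
  qed
  have "indep_var borel ((\<lambda>x. ennreal (exp (- (s * x)))) \<circ> Y) borel ((\<lambda>x. ennreal (exp (- (s * x)))) \<circ> X)"
    by (rule indep_var_compose[OF indep]) auto
  note prod = indep_var_nn_integral_mult[OF this]
  have "ennreal (exp a) = (\<integral>\<^sup>+\<omega>. ennreal (exp (- (s * W \<omega>))) \<partial>M)"
    using nn[OF LW] by simp
  also have "\<dots> = (\<integral>\<^sup>+\<omega>. ennreal (exp (- (s * Y \<omega>))) * ennreal (exp (- (s * X \<omega>))) \<partial>M)"
    using sum by (intro nn_integral_cong_AE, eventually_elim)
      (simp add: algebra_simps flip: ennreal_mult' exp_add)
  also have "\<dots> = (\<integral>\<^sup>+\<omega>. ennreal (exp (- (s * Y \<omega>))) \<partial>M) * ennreal (exp b)"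
    using prod nn[OF LX] by simp
  finally have "ennreal (exp a) * ennreal (exp (- b))
      = (\<integral>\<^sup>+\<omega>. ennreal (exp (- (s * Y \<omega>))) \<partial>M) * (ennreal (exp b) * ennreal (exp (- b)))"
    by (simp add: mult.assoc)
  then have Y: "(\<integral>\<^sup>+\<omega>. ennreal (exp (- (s * Y \<omega>))) \<partial>M) = ennreal (exp (a - b))"
    by (simp add: flip: ennreal_mult' exp_add)
  show "integrable M (\<lambda>\<omega>. exp (- (s * Y \<omega>)))"
    by (rule integrableI_nn_integral_finite[OF _ _ Y]) auto
  show "expectation (\<lambda>\<omega>. exp (- (s * Y \<omega>))) = exp (a - b)"
    by (rule integral_eq_nn_integral[THEN trans]) (auto simp: Y)
qed

section \<open>Stable autoregressive processes\<close>

lemma Laplace_scaled_stable: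
  assumes "0 < \<beta>" "0 < c" "0 < s" and S: "std_one_sided_stable N \<beta> S"
  shows "(\<integral>\<omega>. exp (- (s * (c powr (1 / \<beta>) * S \<omega>))) \<partial>N) = exp (- (c * s powr \<beta>))"
proof -
  have "(\<integral>\<omega>. exp (- ((s * c powr (1 / \<beta>)) * S \<omega>)) \<partial>N) = exp (- ((s * c powr (1 / \<beta>)) powr \<beta>))"
    using assms by (auto simp: std_one_sided_stable_def)
  also have "(s * c powr (1 / \<beta>)) powr \<beta> = c * s powr \<beta>"
    using assms by (simp add: powr_mult powr_powr)
  finally show ?thesis
    by (simp add: mult.assoc)
qed

theorem mainTheorem3:
  fixes M :: "'a measure" and X \<epsilon> :: "nat \<Rightarrow> 'a \<Rightarrow> real" and \<beta> \<rho> :: real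
  assumes "prob_space M"
    and "0 < \<beta>" "\<beta> < 1"
    and "0 < \<rho>" "\<rho> < 1"
    and "strictly_stationary M X"
    and "\<forall>n\<ge>1. AE \<omega> in M. X n \<omega> = \<rho> * X (n - 1) \<omega> + \<epsilon> n \<omega>"
    and "prob_space.indep_vars M (\<lambda>_. borel) \<epsilon> {1..}"
    and "\<forall>m\<ge>1. \<forall>n\<ge>1. distr M borel (\<epsilon> m) = distr M borel (\<epsilon> n)"
    and "\<forall>n\<ge>1. prob_space.indep_var M borel (\<epsilon> n) borel (X (n - 1))"
    and "\<forall>n. std_one_sided_stable M \<beta> (X n)"
  shows "\<forall>n\<ge>1.
      (\<forall>s>0. (\<integral>\<omega>. exp (- (s * \<epsilon> n \<omega>)) \<partial>M) = exp (- ((1 - \<rho> powr \<beta>) * s powr \<beta>))) \<and>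
      (\<forall>(N :: 'b measure) S. prob_space N \<longrightarrow> std_one_sided_stable N \<beta> S \<longrightarrow>
         distr M borel (\<epsilon> n) = distr N borel (\<lambda>\<omega>. (1 - \<rho> powr \<beta>) powr (1 / \<beta>) * S \<omega>)) \<and>
      one_sided_stable M \<beta> (\<epsilon> n)"
proof (intro allI impI)
  fix n :: nat assume n: "1 \<le> n"
  interpret prob_space M by fact
  define c where "c = 1 - \<rho> powr \<beta>"
  define \<sigma> where "\<sigma> = c powr (1 / \<beta>)"
  have "\<rho> powr \<beta> < 1 powr \<beta>"
    using assms(2,4,5) by (intro powr_less_mono2) auto
  then have c: "0 < c" by (simp add: c_def)
  then have \<sigma>: "0 < \<sigma>" by (simp add: \<sigma>_def)
  have indep: "indep_var borel (\<epsilon> n) borel (X (n - 1))"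
    using assms(10) n by blast
  then have meas[measurable]: "random_variable borel (\<epsilon> n)"
    by (rule indep_var_rv1)
  have X: "random_variable borel (X m)" for m
    using assms(11) by (simp add: std_one_sided_stable_def)
  have LX: "expectation (\<lambda>\<omega>. exp (- (s * X m \<omega>))) = exp (- (s powr \<beta>))" if "0 < s" for s m
    using assms(11) that by (simp add: std_one_sided_stable_def)
  have "indep_var borel (id \<circ> \<epsilon> n) borel ((\<lambda>x. \<rho> * x) \<circ> X (n - 1))"
    by (rule indep_var_compose[OF indep]) auto
  then have indep': "indep_var borel (\<epsilon> n) borel (\<lambda>\<omega>. \<rho> * X (n - 1) \<omega>)"
    by (simp add: comp_def)
  have AR: "AE \<omega> in M. X n \<omega> = \<rho> * X (n - 1) \<omega> + \<epsilon> n \<omega>"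
    using assms(7) n by blast
  have past: "expectation (\<lambda>\<omega>. exp (- (s * (\<rho> * X (n - 1) \<omega>)))) = exp (- (\<rho> powr \<beta> * s powr \<beta>))"
    if "0 < s" for s
    using LX[of "s * \<rho>" "n - 1"] that assms(4) by (simp add: powr_mult mult_ac)
  note cancel = Laplace_cancel_indep[OF indep' AR X LX past]
  have L: "expectation (\<lambda>\<omega>. exp (- (s * \<epsilon> n \<omega>))) = exp (- (c * s powr \<beta>))" if "0 < s" for s
    using cancel(2)[OF that that] by (simp add: c_def algebra_simps)
  have "((\<lambda>s. exp (- (c * s powr \<beta>))) \<longlongrightarrow> 0) at_top"
    using assms(2) c by real_asymp
  then have lim: "((\<lambda>s. expectation (\<lambda>\<omega>. exp (- (s * \<epsilon> n \<omega>)))) \<longlongrightarrow> 0) at_top"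
    by (rule Lim_transform_eventually)
       (use eventually_gt_at_top[of "0::real"] in eventually_elim, simp add: L)
  have pos: "AE \<omega> in M. 0 < \<epsilon> n \<omega>"
    using cancel(1) lim by (intro AE_pos_if_Laplace_tendsto_0 meas) auto
  have law: "distr M borel (\<epsilon> n) = distr N borel (\<lambda>\<omega>. \<sigma> * S \<omega>)"
    if N: "prob_space N" and S: "std_one_sided_stable N \<beta> S" for N :: "'b measure" and S
  proof (rule distr_eqI_Laplace[OF prob_space_axioms N meas])
    show "AE \<omega> in M. 0 \<le> \<epsilon> n \<omega>"
      using pos by eventually_elim simp
    have S': "S \<in> borel_measurable N" "AE \<omega> in N. 0 < S \<omega>"
      using S by (auto simp: std_one_sided_stable_def)
    show "(\<lambda>\<omega>. \<sigma> * S \<omega>) \<in> borel_measurable N"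
      using S'(1) by simp
    show "AE \<omega> in N. 0 \<le> \<sigma> * S \<omega>"
      using S'(2) by eventually_elim (use \<sigma> in simp)
    show "(\<integral>\<omega>. exp (- (s * \<epsilon> n \<omega>)) \<partial>M) = (\<integral>\<omega>. exp (- (s * (\<sigma> * S \<omega>))) \<partial>N)" if "0 < s" for s
      using L[OF that] Laplace_scaled_stable[OF assms(2) c that S] by (simp add: \<sigma>_def)
  qed
  have "one_sided_stable M \<beta> (\<epsilon> n)"
    unfolding one_sided_stable_def std_one_sided_stable_def
  proof (intro exI[of _ \<sigma>] conjI allI impI)
    show "AE \<omega> in M. 0 < \<epsilon> n \<omega> / \<sigma>"
      using pos by eventually_elim (use \<sigma> in simp)
    fix s :: real assume s: "0 < s"
    have "c * (s / \<sigma>) powr \<beta> = s powr \<beta>"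
      using s c assms(2) by (simp add: \<sigma>_def powr_divide powr_powr)
    with L[of "s / \<sigma>"] s \<sigma>
    show "expectation (\<lambda>\<omega>. exp (- (s * (\<epsilon> n \<omega> / \<sigma>)))) = exp (- (s powr \<beta>))"
      by simp
  qed (use \<sigma> in simp_all)
  with L law show "(\<forall>s>0. (\<integral>\<omega>. exp (- (s * \<epsilon> n \<omega>)) \<partial>M) = exp (- ((1 - \<rho> powr \<beta>) * s powr \<beta>))) \<and>
      (\<forall>(N :: 'b measure) S. prob_space N \<longrightarrow> std_one_sided_stable N \<beta> S \<longrightarrow>
         distr M borel (\<epsilon> n) = distr N borel (\<lambda>\<omega>. (1 - \<rho> powr \<beta>) powr (1 / \<beta>) * S \<omega>)) \<and>
      one_sided_stable M \<beta> (\<epsilon> n)"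
    unfolding \<sigma>_def c_def by blast
qed

end
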